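(* There is an absolute constant $C>0$ such that for every integer $r\geq 2$ and every odd integer $n$ (for which $C_n$ is defined), $\hat{R}(C_n,r)\leq C\,r^2\,2^{16r^2}\,n$.
   Context: For a graph $H$ and an integer $r\geq 2$, the $r$-color size-Ramsey number $\hat{R}(H,r)$ is the minimum number of edges of a graph $G$ such that every coloring of the edges of $G$ with $r$ colors contains a monochromatic copy of $H$. $C_n$ denotes the cycle on $n$ vertices. *)

theory Defs
  imports Complex_Main "HOL-Library.Ramsey"
begin

type_synonym 'a graph = "'a set \<times> 'a set set"

abbreviation verts :: "'a graph \<Rightarrow> 'a set" where "verts \<equiv> fst"
abbreviation edges :: "'a graph \<Rightarrow> 'a set set" where "edges \<equiv> snd"

definition simple_graph :: "'a graph \<Rightarrow> bool" where
  "simple_graph G \<longleftrightarrow> finite (verts G) \<and> edges G \<subseteq> [verts G]\<^bsup>2\<^esup>"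

definition cycle_graph :: "nat \<Rightarrow> nat graph" where
  "cycle_graph n = ({..<n}, {{i, Suc i mod n} | i. i < n})"

text \<open>A copy of \<open>H\<close> in \<open>G\<close> is a not necessarily induced subgraph of \<open>G\<close> isomorphic to \<open>H\<close>,
  given here by the embedding \<open>f\<close>.\<close>

definition has_mono_copy :: "'a graph \<Rightarrow> 'b graph \<Rightarrow> ('b set \<Rightarrow> nat) \<Rightarrow> nat \<Rightarrow> bool" where
  "has_mono_copy H G \<chi> c \<longleftrightarrow>
     (\<exists>f. inj_on f (verts H) \<and> f ` verts H \<subseteq> verts G \<and>
          (\<forall>e\<in>edges H. f ` e \<in> edges G \<and> \<chi> (f ` e) = c))"

definition ramsey_graph :: "'b graph \<Rightarrow> 'a graph \<Rightarrow> nat \<Rightarrow> bool" where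
  "ramsey_graph G H r \<longleftrightarrow>
     (\<forall>\<chi> \<in> edges G \<rightarrow> {..<r}. \<exists>c<r. has_mono_copy H G \<chi> c)"

text \<open>Every finite graph is isomorphic to one with vertices in \<open>nat\<close>, so the minimum may be
  taken over those.\<close>

definition size_ramsey :: "'a graph \<Rightarrow> nat \<Rightarrow> nat" where
  "size_ramsey H r =
     (LEAST m. \<exists>G :: nat graph. simple_graph G \<and> ramsey_graph G H r \<and> card (edges G) = m)"

lemma simple_graph_cycle:
  assumes "n \<ge> 3"
  shows "simple_graph (cycle_graph n)"
proof -
  have "i \<noteq> Suc i mod n" if "i < n" for i
    using assms that by (cases "Suc i = n") simp_all
  then show ?thesis
    using assms by (fastforce simp: simple_graph_def cycle_graph_def)
qed

text \<open>By Ramsey's theorem the minimum is taken over a nonempty set, hence it is attained.\<close>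

lemma ex_ramsey_graph:
  assumes H: "simple_graph H"
  shows "\<exists>G :: nat graph. simple_graph G \<and> ramsey_graph G H r"
proof -
  obtain N :: nat where N: "partn_lst {..<N} (replicate r (card (verts H))) 2"
    using ramsey_full by blast
  define G where "G = ({..<N}, [{..<N}]\<^bsup>2\<^esup>)"
  have "simple_graph G"
    by (simp add: simple_graph_def G_def)
  moreover have "ramsey_graph G H r"
    unfolding ramsey_graph_def
  proof
    fix \<chi> assume "\<chi> \<in> edges G \<rightarrow> {..<r}"
    then have "\<chi> \<in> [{..<N}]\<^bsup>2\<^esup> \<rightarrow> {..<r}" by (simp add: G_def)
    then obtain c W where c: "c < r" and W: "W \<in> [{..<N}]\<^bsup>(card (verts H))\<^esup>"
      and mono: "\<chi> ` [W]\<^bsup>2\<^esup> \<subseteq> {c}"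
      using partn_lstE[OF N] by (metis length_replicate nth_replicate)
    have "finite W" "card (verts H) = card W" "W \<subseteq> {..<N}"
      using W by (auto simp: nsets_def)
    then obtain f where f: "bij_betw f (verts H) W"
      using H finite_same_card_bij unfolding simple_graph_def by blast
    have "f ` e \<in> [W]\<^bsup>2\<^esup>" if "e \<in> edges H" for e
    proof -
      have "e \<in> [verts H]\<^bsup>2\<^esup>" using H that by (auto simp: simple_graph_def)
      then obtain x y where "e = {x,y}" "x \<in> verts H" "y \<in> verts H" "x \<noteq> y"
        by (rule nsets2_E)
      then show ?thesis
        using f by (auto simp: bij_betw_def inj_on_def)
    qed
    moreover have "[W]\<^bsup>2\<^esup> \<subseteq> edges G"
      using nsets_mono[OF \<open>W \<subseteq> {..<N}\<close>] by (simp add: G_def)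
    ultimately have "f ` e \<in> edges G \<and> \<chi> (f ` e) = c" if "e \<in> edges H" for e
      using mono that by blast
    moreover have "inj_on f (verts H)" "f ` verts H \<subseteq> verts G"
      using f \<open>W \<subseteq> {..<N}\<close> by (auto simp: bij_betw_def G_def)
    ultimately have "has_mono_copy H G \<chi> c"
      unfolding has_mono_copy_def by blast
    then show "\<exists>c<r. has_mono_copy H G \<chi> c" using c by blast
  qed
  ultimately show ?thesis by blast
qed

lemma size_ramsey_attained:
  assumes "simple_graph H"
  shows "\<exists>G :: nat graph. simple_graph G \<and> ramsey_graph G H r \<and> card (edges G) = size_ramsey H r"
proof -
  have "\<exists>m. \<exists>G :: nat graph. simple_graph G \<and> ramsey_graph G H r \<and> card (edges G) = m"
    using ex_ramsey_graph[OF assms] by metis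
  then show ?thesis
    unfolding size_ramsey_def by (rule LeastI_ex)
qed

end

theory Submission
  imports Defs
begin

text \<open>
  If \<open>n < 2 ^ (4 * r)\<close>, a complete graph serves as host. For larger \<open>n\<close> the host is a sparse graph
  on \<open>q * n\<close> vertices, \<open>q = 2 ^ (3 * r\<^sup>2 + 4 * r + 1)\<close>, in which any two disjoint sets of \<open>n\<close> vertices
  are joined by an edge. Colours are eliminated one at a time. Split the current vertex set into two
  halves \<open>A\<close> and \<open>B\<close>. If some colour has a hole, that is, two large subsets of \<open>A\<close> and \<open>B\<close> with no edge
  of that colour between them, pass to this pair; the host has no hole for all colours together, so
  eventually some colour \<open>c\<close> has no hole relative to the current pair. Most vertices of \<open>A\<close> then have
  many vertices reachable by paths of one fixed length inside either of two reserved parts, and a third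
  part contains a long path. An edge \<open>a a'\<close> of colour \<open>c\<close> inside \<open>A\<close> is completed to a cycle of the
  prescribed odd length by growing trees from \<open>a\<close> and \<open>a'\<close> and linking their leaves by a subpath of
  the right length. Hence, without such a cycle, a constant fraction of \<open>A\<close> spans no edge of colour
  \<open>c\<close>. A step with \<open>j\<close> colours left costs a factor \<open>2 * 64 ^ j\<close>, which multiplies up to \<open>q / 2\<close>.
\<close>

section \<open>Cycles, paths and pairs of sets without holes\<close>

text \<open>The vertices are listed in cyclic order and the closing pair is required separately. For
  symmetric \<open>R\<close> and \<open>n = 2\<close> a single edge would qualify; genuine cycles
  start at \<open>n = 3\<close>.\<close>

definition has_cycle :: "('a \<Rightarrow> 'a \<Rightarrow> bool) \<Rightarrow> nat \<Rightarrow> bool" where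
  "has_cycle R n \<longleftrightarrow> (\<exists>xs. length xs = n \<and> distinct xs \<and> successively R xs \<and> R (last xs) (hd xs))"

text \<open>Lengths of paths are list lengths and thus count vertices: a list of length
  \<open>Suc k\<close> is a path with \<open>k\<close> edges. The empty list counts as a path, which
  gives depth-first search its initial state.\<close>

definition path_in :: "('a \<Rightarrow> 'a \<Rightarrow> bool) \<Rightarrow> 'a set \<Rightarrow> 'a list \<Rightarrow> bool" where
  "path_in R V xs \<longleftrightarrow> distinct xs \<and> set xs \<subseteq> V \<and> successively R xs"

definition nbrs :: "('a \<Rightarrow> 'a \<Rightarrow> bool) \<Rightarrow> 'a set \<Rightarrow> 'a set" where
  "nbrs R Z = {y. \<exists>x\<in>Z. R x y}"

text \<open>This is the absence of a bipartite hole of size \<open>e\<close>. It replaces any degree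
  condition, because it passes to subsets with the same \<open>e\<close>.\<close>

definition joined :: "('a \<Rightarrow> 'a \<Rightarrow> bool) \<Rightarrow> 'a set \<Rightarrow> 'a set \<Rightarrow> nat \<Rightarrow> bool" where
  "joined R A B e \<longleftrightarrow>
     (\<forall>X\<subseteq>A. \<forall>Y\<subseteq>B. e \<le> card X \<longrightarrow> e \<le> card Y \<longrightarrow> (\<exists>x\<in>X. \<exists>y\<in>Y. R x y))"

lemma joinedD:
  "joined R A B e \<Longrightarrow> X \<subseteq> A \<Longrightarrow> Y \<subseteq> B \<Longrightarrow> e \<le> card X \<Longrightarrow> e \<le> card Y \<Longrightarrow> \<exists>x\<in>X. \<exists>y\<in>Y. R x y"
  unfolding joined_def by blast

lemma joined_mono: "joined R A B e \<Longrightarrow> A' \<subseteq> A \<Longrightarrow> B' \<subseteq> B \<Longrightarrow> joined R A' B' e"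
  unfolding joined_def by (meson subset_trans)

lemma joined_sym: "joined R A B e \<Longrightarrow> symp R \<Longrightarrow> joined R B A e"
  unfolding joined_def by (metis sympD)

text \<open>Otherwise \<open>X\<close> and its non-neighbours in \<open>B\<close> would form a
  hole.\<close>

lemma card_non_nbrs_less:
  assumes "joined R A B e" "X \<subseteq> A" "e \<le> card X"
  shows "card (B - nbrs R X) < e"
proof (rule ccontr)
  assume "\<not> card (B - nbrs R X) < e"
  then have "\<exists>x\<in>X. \<exists>y\<in>B - nbrs R X. R x y"
    using assms unfolding joined_def by (meson Diff_subset linorder_not_le)
  then show False by (auto simp: nbrs_def)
qed

section \<open>Long paths, expansion and trees\<close>

text \<open>Remove a maximum independent set \<open>I\<close>, which costs at most \<open>a\<close>
  vertices, and take a path on \<open>Suc l\<close> vertices in the rest by induction. Its first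
  vertex has a neighbour in \<open>I\<close>, since it could otherwise be added to \<open>I\<close>;
  this neighbour extends the path.\<close>

lemma ex_path_or_independent:
  assumes "finite X" "l * a < card X"
    and "\<And>I. I \<subseteq> X \<Longrightarrow> (\<forall>x\<in>I. \<forall>y\<in>I. \<not> R x y) \<Longrightarrow> card I \<le> a"
    and "symp R" "irreflp R"
  shows "\<exists>xs. path_in R X xs \<and> length xs = Suc l"
  using assms(1-3)
proof (induction l arbitrary: X)
  case 0
  then obtain x where "x \<in> X" by fastforce
  then have "path_in R X [x]" by (simp add: path_in_def)
  then show ?case by (metis length_Cons list.size(3))
next
  case (Suc l)
  define P where "P I \<longleftrightarrow> I \<subseteq> X \<and> (\<forall>x\<in>I. \<forall>y\<in>I. \<not> R x y)" for I
  have "\<exists>I. P I \<and> (\<forall>J. P J \<longrightarrow> card J \<le> card I)"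
  proof (rule ex_has_greatest_nat)
    show "P {}" by (simp add: P_def)
    show "\<forall>J. P J \<longrightarrow> card J < Suc (card X)"
      using Suc.prems(1) by (auto simp: P_def card_mono less_Suc_eq_le)
  qed
  then obtain I where I: "P I" and max: "\<And>J. P J \<Longrightarrow> card J \<le> card I" by blast
  have fI: "finite I" using I Suc.prems(1) finite_subset unfolding P_def by blast
  have "card I \<le> a" using Suc.prems(3) I unfolding P_def by blast
  moreover have "card (X - I) = card X - card I"
    using I fI by (auto simp: P_def card_Diff_subset)
  ultimately have "l * a < card (X - I)" using Suc.prems(2) by simp
  moreover have "card J \<le> a" if "J \<subseteq> X - I" "\<forall>x\<in>J. \<forall>y\<in>J. \<not> R x y" for J
    using Suc.prems(3) that by blast
  ultimately obtain xs where xs: "path_in R (X - I) xs" "length xs = Suc l"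
    using Suc.IH[of "X - I"] Suc.prems(1) by blast
  then obtain v ys where v: "xs = v # ys" by (cases xs) auto
  then have vX: "v \<in> X" "v \<notin> I" using xs by (auto simp: path_in_def)
  have "\<not> P (insert v I)" using max[of "insert v I"] fI vX by fastforce
  then obtain w where "w \<in> I" "R w v"
    using I vX assms(4,5) unfolding P_def by (metis insert_iff insert_subset irreflpD sympD)
  then have "path_in R X (w # xs)"
    using xs I v by (auto simp: path_in_def P_def)
  then show ?case using xs(2) by (metis length_Cons)
qed

text \<open>Depth-first search: \<open>S\<close> is the set of vertices already abandoned. Each step raises
  \<open>2 * card S + length p\<close> by exactly one, so this quantity takes every value.\<close>

lemma dfs_state:
  assumes "finite V" "symp R" "j \<le> 2 * card V"
  shows "\<exists>S p. S \<subseteq> V \<and> path_in R (V - S) p \<and> 2 * card S + length p = j \<and>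
           (\<forall>x\<in>S. \<forall>y\<in>V - S - set p. \<not> R x y)"
  using assms(3)
proof (induction j)
  case 0
  show ?case by (rule exI[of _ "{}"], rule exI[of _ "[]"]) (simp add: path_in_def)
next
  case (Suc j)
  then obtain S p where S: "S \<subseteq> V" and p: "path_in R (V - S) p"
    and j: "2 * card S + length p = j" and no: "\<forall>x\<in>S. \<forall>y\<in>V - S - set p. \<not> R x y"
    by auto
  have fS: "finite S" using S assms(1) finite_subset by blast
  show ?case
  proof (cases p)
    case Nil
    then have "card S < card V" using j Suc.prems by simp
    then obtain v where v: "v \<in> V - S"
      by (metis DiffI S card_mono fS linorder_not_le subsetI)
    then have "path_in R (V - S) [v]" by (simp add: path_in_def)
    then show ?thesis using S j no Nil
      by (intro exI[of _ S] exI[of _ "[v]"]) auto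
  next
    case (Cons v p')
    show ?thesis
    proof (cases "\<exists>w\<in>V - S - set p. R v w")
      case True
      then obtain w where w: "w \<in> V - S - set p" "R v w" by blast
      then have "path_in R (V - S) (w # p)"
        using p Cons assms(2) by (auto simp: path_in_def dest: sympD)
      then show ?thesis using S j no
        by (intro exI[of _ S] exI[of _ "w # p"]) auto
    next
      case False
      have vS: "v \<notin> S" "v \<in> V" using p Cons by (auto simp: path_in_def)
      have "path_in R (V - insert v S) p'"
        using p Cons by (auto simp: path_in_def successively_Cons)
      moreover have "2 * card (insert v S) + length p' = Suc j"
        using fS vS j Cons by simp
      moreover have "\<forall>x\<in>insert v S. \<forall>y\<in>V - insert v S - set p'. \<not> R x y"
        using no False Cons by auto
      ultimately show ?thesis using S vS by (intro exI[of _ "insert v S"] exI[of _ p']) auto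
    qed
  qed
qed

text \<open>Depth-first search is stopped when the set \<open>S\<close> of abandoned vertices and
  the set \<open>T\<close> of untouched ones have equal size, that is, at
  \<open>j = card (A \<union> B)\<close>. No edge runs between \<open>S\<close> and
  \<open>T\<close>, so one of \<open>S \<inter> A\<close>, \<open>T \<inter> B\<close> and one of
  \<open>T \<inter> A\<close>, \<open>S \<inter> B\<close> has fewer than \<open>e\<close> vertices.
  In each of the four cases counting leaves at least \<open>l\<close> vertices for the current
  path.\<close>

lemma joined_ex_long_path:
  assumes fin: "finite A" "finite B" and disj: "A \<inter> B = {}" and "symp R"
    and jn: "joined R A B e" and A: "card A = l + 2 * e" and B: "card B = l + 2 * e"
  shows "\<exists>p. path_in R (A \<union> B) p \<and> l \<le> length p"
proof -
  have cV: "card (A \<union> B) = card A + card B" using fin disj by (simp add: card_Un_disjoint)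
  obtain S p where S: "S \<subseteq> A \<union> B" and p: "path_in R (A \<union> B - S) p"
    and j: "2 * card S + length p = card (A \<union> B)"
    and no: "\<forall>x\<in>S. \<forall>y\<in>A \<union> B - S - set p. \<not> R x y"
    using dfs_state[of "A \<union> B" R "card (A \<union> B)"] fin \<open>symp R\<close> by auto
  define T where "T = A \<union> B - S - set p"
  have fST: "finite S" "finite T" using S fin finite_subset unfolding T_def by blast+
  have lp: "card (set p) = length p" using p by (simp add: path_in_def distinct_card)
  have sp: "set p \<subseteq> A \<union> B - S" using p by (simp add: path_in_def)
  have "card T = card (A \<union> B) - card S - length p"
    unfolding T_def using S sp fST lp by (simp add: card_Diff_subset)
  then have TS: "card T = card S" using j by simp
  have hole1: "card (S \<inter> A) < e \<or> card (T \<inter> B) < e"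
    using joinedD[OF jn, of "S \<inter> A" "T \<inter> B"] no unfolding T_def by fastforce
  have hole2: "card (T \<inter> A) < e \<or> card (S \<inter> B) < e"
    using joinedD[OF joined_sym[OF jn \<open>symp R\<close>], of "S \<inter> B" "T \<inter> A"] no
    unfolding T_def by fastforce
  have splitU: "card U = card (U \<inter> A) + card (U \<inter> B)" if "U \<subseteq> A \<union> B" for U
  proof -
    have "U = (U \<inter> A) \<union> (U \<inter> B)" using that by blast
    moreover have "card ((U \<inter> A) \<union> (U \<inter> B)) = card (U \<inter> A) + card (U \<inter> B)"
      using fin disj by (intro card_Un_disjoint) auto
    ultimately show ?thesis by simp
  qed
  have part: "card X \<le> card (S \<inter> X) + card (T \<inter> X) + length p" if "X \<subseteq> A \<union> B" for X
  proof -
    have "X \<subseteq> (S \<inter> X) \<union> (T \<inter> X) \<union> set p" using that unfolding T_def by blast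
    then have "card X \<le> card ((S \<inter> X) \<union> (T \<inter> X) \<union> set p)"
      using fST by (intro card_mono) auto
    also have "\<dots> \<le> card (S \<inter> X) + card (T \<inter> X) + length p"
      using card_Un_le[of "(S \<inter> X) \<union> (T \<inter> X)" "set p"] card_Un_le[of "S \<inter> X" "T \<inter> X"] lp
      by linarith
    finally show ?thesis .
  qed
  have "T \<subseteq> A \<union> B" unfolding T_def by blast
  then have "l \<le> length p"
    using hole1 hole2 part[of A] part[of B] splitU[OF S] splitU[of T] TS j cV A B by auto
  moreover have "path_in R (A \<union> B) p" using p by (auto simp: path_in_def)
  ultimately show ?thesis by blast
qed

text \<open>The removed set \<open>X\<close> is a largest small set with few outside neighbours: adding a
  non-expanding set to it would produce a larger one.\<close>

lemma ex_expanding_part: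
  assumes "finite V"
    and big: "\<And>Z. Z \<subseteq> V \<Longrightarrow> f \<le> card Z \<Longrightarrow> (2 * D + 2) * f \<le> card (nbrs R Z \<inter> V)" and "f > 0"
  shows "\<exists>X\<subseteq>V. card X < f \<and>
     (\<forall>Z\<subseteq>V - X. card Z \<le> f \<longrightarrow> D * card Z \<le> card (nbrs R Z \<inter> (V - X)))"
proof -
  define P where "P X \<longleftrightarrow> X \<subseteq> V \<and> card X < f \<and> card (nbrs R X \<inter> V - X) \<le> D * card X" for X
  have "\<exists>X. P X \<and> (\<forall>Y. P Y \<longrightarrow> card Y \<le> card X)"
  proof (rule ex_has_greatest_nat)
    show "P {}" using \<open>f > 0\<close> by (simp add: P_def nbrs_def)
    show "\<forall>Y. P Y \<longrightarrow> card Y < Suc (card V)"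
      using assms(1) by (auto simp: P_def card_mono less_Suc_eq_le)
  qed
  then obtain X where X: "P X" and max: "\<And>Y. P Y \<Longrightarrow> card Y \<le> card X" by blast
  have fX: "finite X" using X assms(1) finite_subset unfolding P_def by blast
  have "D * card Z \<le> card (nbrs R Z \<inter> (V - X))" if Z: "Z \<subseteq> V - X" "card Z \<le> f" for Z
  proof (rule ccontr)
    assume *: "\<not> ?thesis"
    have fZ: "finite Z" using Z assms(1) finite_subset by blast
    have cXZ: "card (X \<union> Z) = card X + card Z" using Z fX fZ by (intro card_Un_disjoint) auto
    have Zpos: "card Z > 0" using * by (cases "card Z") auto
    have "nbrs R (X \<union> Z) \<inter> V - (X \<union> Z) \<subseteq> (nbrs R X \<inter> V - X) \<union> (nbrs R Z \<inter> (V - X))"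
      by (auto simp: nbrs_def)
    then have "card (nbrs R (X \<union> Z) \<inter> V - (X \<union> Z)) \<le> card ((nbrs R X \<inter> V - X) \<union> (nbrs R Z \<inter> (V - X)))"
      using assms(1) by (intro card_mono) auto
    also have "\<dots> \<le> card (nbrs R X \<inter> V - X) + card (nbrs R Z \<inter> (V - X))" by (rule card_Un_le)
    also have "\<dots> \<le> D * card (X \<union> Z)" using X * unfolding P_def cXZ by (simp add: algebra_simps)
    finally have few: "card (nbrs R (X \<union> Z) \<inter> V - (X \<union> Z)) \<le> D * card (X \<union> Z)" .
    show False
    proof (cases "card (X \<union> Z) < f")
      case True
      then have "P (X \<union> Z)" using few X Z unfolding P_def by blast
      then show False using max cXZ Zpos by fastforce
    next
      case False
      \<comment> \<open>This case explains the factor \<open>2 * D + 2\<close>: a union of fewer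
        than \<open>2 * f\<close> vertices has, together with its few outside neighbours, fewer than
        \<open>D * (2 * f) + 2 * f\<close> vertices.\<close>
      have lt: "card (X \<union> Z) < 2 * f" using cXZ X Z unfolding P_def by simp
      have "(2 * D + 2) * f \<le> card (nbrs R (X \<union> Z) \<inter> V)"
        using big[of "X \<union> Z"] False X Z unfolding P_def by force
      also have "\<dots> \<le> card ((nbrs R (X \<union> Z) \<inter> V - (X \<union> Z)) \<union> (X \<union> Z))"
        using assms(1) fX fZ by (intro card_mono) auto
      also have "\<dots> \<le> D * card (X \<union> Z) + card (X \<union> Z)"
        using few card_Un_le by (meson add_right_mono le_trans)
      also have "\<dots> < D * (2 * f) + 2 * f"
        using lt by (intro add_le_less_mono mult_left_mono) auto
      finally show False by (simp add: algebra_simps)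
    qed
  qed
  then show ?thesis using X unfolding P_def by blast
qed

text \<open>A binary tree with root \<open>b\<close> is grown level by level; \<open>U\<close> is
  its vertex set and \<open>S\<close> its last level. The current level has at least
  \<open>4 * 2 ^ k\<close> neighbours, of which fewer than \<open>2 ^ Suc k\<close> lie in
  \<open>U\<close>, so enough new vertices remain to double the level. Hence all leaves have tree
  paths of the same length to \<open>b\<close>.\<close>

lemma ex_sphere:
  assumes "finite V" "symp R" "b \<in> V"
    and ex: "\<And>Z. Z \<subseteq> V \<Longrightarrow> card Z \<le> f \<Longrightarrow> 4 * card Z \<le> card (nbrs R Z \<inter> V)"
    and "\<And>i. i < k \<Longrightarrow> 2 ^ i \<le> f"
  shows "\<exists>S U. S \<subseteq> U \<and> U \<subseteq> V \<and> card S = 2 ^ k \<and> card U < 2 ^ Suc k \<and>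
    (\<forall>s\<in>S. \<exists>xs. path_in R U xs \<and> length xs = Suc k \<and> hd xs = s \<and> last xs = b)"
  using assms(5)
proof (induction k)
  case 0
  have "path_in R {b} [b]" by (simp add: path_in_def)
  then show ?case using \<open>b \<in> V\<close>
    by (intro exI[of _ "{b}"]) (auto intro!: exI[of _ "[b]"])
next
  case (Suc k)
  then obtain S U where SU: "S \<subseteq> U" "U \<subseteq> V" and cS: "card S = 2 ^ k" and cU: "card U < 2 ^ Suc k"
    and pth: "\<And>s. s \<in> S \<Longrightarrow> \<exists>xs. path_in R U xs \<and> length xs = Suc k \<and> hd xs = s \<and> last xs = b"
    by force
  have fU: "finite U" using SU assms(1) finite_subset by blast
  have "4 * 2 ^ k \<le> card (nbrs R S \<inter> V)"
    using ex[of S] SU cS Suc.prems[of k] by auto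
  moreover have "card (nbrs R S \<inter> V) - card U \<le> card (nbrs R S \<inter> V - U)"
    using diff_card_le_card_Diff[OF fU] by blast
  ultimately have "2 ^ Suc k \<le> card (nbrs R S \<inter> V - U)" using cU by simp
  then obtain S' where S': "S' \<subseteq> nbrs R S \<inter> V - U" "card S' = 2 ^ Suc k" "finite S'"
    by (meson obtain_subset_with_card_n)
  have "card (U \<union> S') < 2 ^ Suc (Suc k)"
    using card_Un_le[of U S'] S'(2) cU by simp
  moreover have "\<exists>xs. path_in R (U \<union> S') xs \<and> length xs = Suc (Suc k) \<and> hd xs = s \<and> last xs = b"
    if s: "s \<in> S'" for s
  proof -
    obtain t where t: "t \<in> S" "R t s" using s S' by (auto simp: nbrs_def)
    then obtain xs where xs: "path_in R U xs" "length xs = Suc k" "hd xs = t" "last xs = b"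
      using pth by blast
    then have "xs \<noteq> []" by auto
    then have "path_in R (U \<union> S') (s # xs)"
      using xs t s S' assms(2) by (auto simp: path_in_def successively_Cons dest: sympD)
    then show ?thesis using xs \<open>xs \<noteq> []\<close> by (intro exI[of _ "s # xs"]) auto
  qed
  ultimately show ?case using S' SU
    by (intro exI[of _ S'] exI[of _ "U \<union> S'"]) auto
qed

section \<open>Cycles of prescribed odd length in a joined pair\<close>

text \<open>With \<open>P\<close> as membership in one side, this says that the parity of a position
  on a bipartite path determines the side of the vertex there.\<close>

lemma alternating_nth:
  assumes "successively (\<lambda>x y. P x \<noteq> P y) xs" "i < length xs"
  shows "P (xs ! i) \<longleftrightarrow> (P (xs ! 0) \<longleftrightarrow> even i)"
  using assms(2)
proof (induction i)
  case (Suc i)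
  then have "P (xs ! i) \<noteq> P (xs ! Suc i)"
    using assms(1) by (simp add: successively_conv_nth)
  then show ?case using Suc by auto
qed simp

text \<open>A set of \<open>2 * e\<close> vertices has \<open>e\<close> of them on one side, and
  these see all but fewer than \<open>e\<close> of the \<open>21 * e\<close> vertices opposite. The
  resulting \<open>20 * e\<close> is exactly what \<open>ex_expanding_part\<close> asks for with
  \<open>D = 4\<close> and \<open>f = 2 * e\<close>. Fewer than \<open>2 * e\<close> vertices are
  discarded, and each remaining vertex is the root of a tree with \<open>2 ^ k\<close> leaves, all
  levels before the last being small enough to expand.\<close>

lemma ex_expanding_reserve:
  assumes fin: "finite A" "finite B" and disj: "A \<inter> B = {}" and "symp R"
    and jn: "joined R A B e" and A: "card A = 21 * e" and B: "card B = 21 * e" and "e > 0"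
    and k: "\<And>i. i < k \<Longrightarrow> 2 ^ i \<le> 2 * e" and k': "2 * e \<le> 2 ^ k"
  shows "\<exists>V \<subseteq> A \<union> B. e \<le> card (V \<inter> B) \<and>
     (\<forall>b\<in>V. \<exists>S\<subseteq>V. e \<le> card S \<and>
        (\<forall>s\<in>S. \<exists>xs. path_in R V xs \<and> length xs = Suc k \<and> hd xs = s \<and> last xs = b))"
proof -
  have big: "(2 * 4 + 2) * (2 * e) \<le> card (nbrs R Z \<inter> (A \<union> B))"
    if Z: "Z \<subseteq> A \<union> B" "2 * e \<le> card Z" for Z
  proof -
    have *: "20 * e \<le> card (nbrs R Z \<inter> (A \<union> B))"
      if "joined R C D e" "e \<le> card (Z \<inter> C)" "card D = 21 * e" "D \<subseteq> A \<union> B" for C D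
    proof -
      have fD: "finite D" using that fin finite_subset by blast
      have "card (D - nbrs R (Z \<inter> C)) < e"
        using card_non_nbrs_less[OF that(1) _ that(2)] by blast
      moreover have "card D \<le> card (D \<inter> nbrs R (Z \<inter> C)) + card (D - nbrs R (Z \<inter> C))"
        using card_Un_le[of "D \<inter> nbrs R (Z \<inter> C)" "D - nbrs R (Z \<inter> C)"] by (simp add: Int_Diff_Un)
      moreover have "card (D \<inter> nbrs R (Z \<inter> C)) \<le> card (nbrs R Z \<inter> (A \<union> B))"
        using fin that(4) by (intro card_mono) (auto simp: nbrs_def)
      ultimately show ?thesis using that(3) by linarith
    qed
    have "Z = (Z \<inter> A) \<union> (Z \<inter> B)" using Z by blast
    then have "card Z \<le> card (Z \<inter> A) + card (Z \<inter> B)" by (metis card_Un_le)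
    then have "e \<le> card (Z \<inter> A) \<or> e \<le> card (Z \<inter> B)" using Z by linarith
    then show ?thesis
      using *[OF jn _ B] *[OF joined_sym[OF jn \<open>symp R\<close>] _ A] by auto
  qed
  obtain X where X: "X \<subseteq> A \<union> B" "card X < 2 * e"
    and ex: "\<And>Z. Z \<subseteq> A \<union> B - X \<Longrightarrow> card Z \<le> 2 * e \<Longrightarrow> 4 * card Z \<le> card (nbrs R Z \<inter> (A \<union> B - X))"
  proof -
    have "finite (A \<union> B)" "0 < 2 * e" using fin \<open>e > 0\<close> by auto
    from ex_expanding_part[OF this(1) big this(2)] show ?thesis using that by blast
  qed
  let ?V = "A \<union> B - X"
  have "finite X" using X fin finite_subset by blast
  then have "card B - card X \<le> card (B - X)" by (rule diff_card_le_card_Diff)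
  then have "e \<le> card (B - X)" using B X by linarith
  moreover have "?V \<inter> B = B - X" by blast
  moreover have "\<exists>S\<subseteq>?V. e \<le> card S \<and>
        (\<forall>s\<in>S. \<exists>xs. path_in R ?V xs \<and> length xs = Suc k \<and> hd xs = s \<and> last xs = b)"
    if b: "b \<in> ?V" for b
  proof -
    obtain S U where SU: "S \<subseteq> U" "U \<subseteq> ?V" "card S = 2 ^ k"
      "\<And>s. s \<in> S \<Longrightarrow> \<exists>xs. path_in R U xs \<and> length xs = Suc k \<and> hd xs = s \<and> last xs = b"
      using ex_sphere[of ?V R b "2 * e" k] fin \<open>symp R\<close> b ex k by (metis finite_Diff finite_Un)
    then have "\<exists>xs. path_in R ?V xs \<and> length xs = Suc k \<and> hd xs = s \<and> last xs = b" if "s \<in> S" for s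
      using that SU(2) unfolding path_in_def by (meson subset_trans)
    then show ?thesis using SU k' by (intro exI[of _ S]) auto
  qed
  ultimately show ?thesis by (intro exI[of _ ?V]) auto
qed

text \<open>All but fewer than \<open>e\<close> vertices of \<open>Q\<close> are adjacent to \<open>S\<close>, likewise for \<open>S'\<close>, so one of
  the \<open>2 * e\<close> subpaths of the right length starting at even positions has both ends adjacent.\<close>

lemma ex_connecting_subpath:
  assumes p: "path_in R V p" "5 * e \<le> length p" and t: "odd t" "t \<le> e"
    and Q: "\<And>i. i < length p \<Longrightarrow> even i \<Longrightarrow> p ! i \<in> Q" "finite Q"
    and S: "card (Q - nbrs R S) < e" "card (Q - nbrs R S') < e"
  shows "\<exists>q. path_in R V q \<and> length q = t \<and> hd q \<in> nbrs R S \<and> last q \<in> nbrs R S'"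
proof -
  \<comment> \<open>Here \<open>j\<close> indexes the start \<open>2 * j\<close> of a candidate
    subpath, and \<open>d\<close> is \<open>0\<close> for its first and \<open>t - 1\<close> for its
    last vertex. Both offsets are even and below \<open>e\<close>, so every position
    \<open>2 * j + d\<close> is even and below \<open>5 * e\<close>.\<close>
  have few: "card {j. j < 2 * e \<and> p ! (2 * j + d) \<notin> nbrs R T} < e"
    if T: "card (Q - nbrs R T) < e" and d: "even d" "d < e" for T d
  proof -
    have "inj_on (\<lambda>j. p ! (2 * j + d)) {j. j < 2 * e \<and> p ! (2 * j + d) \<notin> nbrs R T}"
      using p d by (auto simp: inj_on_def path_in_def nth_eq_iff_index_eq)
    moreover have "(\<lambda>j. p ! (2 * j + d)) ` {j. j < 2 * e \<and> p ! (2 * j + d) \<notin> nbrs R T} \<subseteq> Q - nbrs R T"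
      using Q(1) p(2) d by auto
    ultimately show ?thesis using T Q(2) by (meson card_inj_on_le finite_Diff le_less_trans)
  qed
  let ?J = "\<lambda>d T. {j. j < 2 * e \<and> p ! (2 * j + d) \<notin> nbrs R T}"
  have "card (?J 0 S \<union> ?J (t - 1) S') < 2 * e"
    using card_Un_le[of "?J 0 S" "?J (t - 1) S'"] few[OF S(1), of 0] few[OF S(2), of "t - 1"] t
    by (cases t) fastforce+
  moreover have "card {..<2 * e} \<le> card (?J 0 S \<union> ?J (t - 1) S')" if "{..<2 * e} \<subseteq> ?J 0 S \<union> ?J (t - 1) S'"
    using that by (intro card_mono) auto
  ultimately have "\<not> {..<2 * e} \<subseteq> ?J 0 S \<union> ?J (t - 1) S'" by auto
  then obtain j where j: "j < 2 * e" "p ! (2 * j) \<in> nbrs R S" "p ! (2 * j + (t - 1)) \<in> nbrs R S'"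
    by auto
  define q where "q = take t (drop (2 * j) p)"
  have len: "length q = t" using p(2) j(1) t by (simp add: q_def)
  moreover have "path_in R V q"
    using p(1) set_take_subset set_drop_subset unfolding path_in_def q_def
    by (metis append_take_drop_id distinct_drop distinct_take subset_trans successively_append_iff)
  moreover have "q \<noteq> []" using len t by auto
  then have "hd q = p ! (2 * j)" "last q = p ! (2 * j + (t - 1))"
    using len t p(2) j(1) by (auto simp: hd_conv_nth last_conv_nth q_def)
  ultimately show ?thesis using j by auto
qed

text \<open>A bipartite path between two vertices \<open>a\<close>, \<open>a'\<close> of
  \<open>A\<close> has an odd number of vertices, so an edge inside \<open>A\<close> closes it to an
  odd cycle. Paths on exactly \<open>n\<close> vertices exist between any two distinct vertices of a
  large set \<open>W\<close>, so \<open>W\<close> spans no edge.\<close>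

lemma joined_pair_cycle_or_independent:
  assumes fin: "finite A" "finite B" and disj: "A \<inter> B = {}" and sym: "symp R" and irr: "irreflp R"
    and jn: "joined R A B e" and A: "64 * e \<le> card A" and B: "64 * e \<le> card B"
    and n: "odd n" "5 \<le> n" "n \<le> e" "2 * e \<le> 2 ^ ((n - 5) div 2)"
    and nocyc: "\<not> has_cycle R n"
  shows "\<exists>W\<subseteq>A. 12 * e \<le> card W \<and> (\<forall>x\<in>W. \<forall>y\<in>W. \<not> R x y)"
proof -
  \<comment> \<open>Only edges between \<open>A\<close> and \<open>B\<close> are kept, so that sides
    alternate along every path.\<close>
  define H where "H x y \<longleftrightarrow> R x y \<and> (x \<in> A \<and> y \<in> B \<or> x \<in> B \<and> y \<in> A)" for x y
  have symH: "symp H" using sym by (auto simp: symp_def H_def)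
  have HR: "\<And>x y. H x y \<Longrightarrow> R x y" by (simp add: H_def)
  have jnH: "joined H A B e"
    using jn unfolding joined_def H_def by (meson subsetD)
  have e: "e > 0" using n by simp
  \<comment> \<open>Two parts of \<open>21 * e\<close> vertices are for the trees, and one of
    \<open>8 * e = 6 * e + 2 * e\<close> is for a path on \<open>6 * e\<close> vertices. Of the
    remaining \<open>14 * e\<close> vertices in \<open>A\<close>, fewer than \<open>2 * e\<close>
    will be lost, which leaves \<open>12 * e\<close> for \<open>W\<close>.\<close>
  have split: "\<exists>C1 C2 C3. C1 \<subseteq> C \<and> C2 \<subseteq> C - C1 \<and> C3 \<subseteq> C - C1 - C2 \<and>
     card C1 = 21 * e \<and> card C2 = 21 * e \<and> card C3 = 8 * e" if C: "64 * e \<le> card C" for C :: "'a set"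
  proof -
    obtain C1 where C1: "C1 \<subseteq> C" "card C1 = 21 * e" "finite C1"
      using C obtain_subset_with_card_n[of "21 * e" C] by auto
    have "43 * e \<le> card (C - C1)" using diff_card_le_card_Diff[OF C1(3), of C] C C1 by linarith
    then obtain C2 where C2: "C2 \<subseteq> C - C1" "card C2 = 21 * e" "finite C2"
      using obtain_subset_with_card_n[of "21 * e" "C - C1"] by auto
    have "22 * e \<le> card (C - C1 - C2)"
      using diff_card_le_card_Diff[OF C2(3), of "C - C1"] \<open>43 * e \<le> card (C - C1)\<close> C2 by linarith
    then obtain C3 where "C3 \<subseteq> C - C1 - C2" "card C3 = 8 * e"
      using obtain_subset_with_card_n[of "8 * e" "C - C1 - C2"] by auto
    then show ?thesis using C1 C2 by blast
  qed
  obtain A1 A2 A3 where As: "A1 \<subseteq> A" "A2 \<subseteq> A - A1" "A3 \<subseteq> A - A1 - A2"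
     "card A1 = 21 * e" "card A2 = 21 * e" "card A3 = 8 * e" using split[OF A] by blast
  obtain B1 B2 B3 where Bs: "B1 \<subseteq> B" "B2 \<subseteq> B - B1" "B3 \<subseteq> B - B1 - B2"
     "card B1 = 21 * e" "card B2 = 21 * e" "card B3 = 8 * e" using split[OF B] by blast
  have sub: "A2 \<subseteq> A" "A3 \<subseteq> A" "B2 \<subseteq> B" "B3 \<subseteq> B" using As Bs by auto
  have finAB: "finite A1" "finite A2" "finite A3" "finite B1" "finite B2" "finite B3"
    using As(1) Bs(1) sub fin finite_subset by metis+
  \<comment> \<open>Minimality keeps all levels before level \<open>k\<close> within the range of
    expansion, and \<open>k \<le> (n - 5) div 2\<close> leaves at least one vertex for the linking
    subpath.\<close>
  define k where "k = (LEAST k. 2 * e \<le> 2 ^ k)"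
  have k': "2 * e \<le> 2 ^ k" unfolding k_def using n(4) by (rule LeastI)
  have kn: "k \<le> (n - 5) div 2" unfolding k_def using n(4) by (rule Least_le)
  have k: "2 ^ i \<le> 2 * e" if "i < k" for i
    using not_less_Least[of i "\<lambda>k. 2 * e \<le> 2 ^ k"] that unfolding k_def by simp
  obtain V1 where V1: "V1 \<subseteq> A1 \<union> B1" "e \<le> card (V1 \<inter> B1)"
    and S1: "\<And>b. b \<in> V1 \<Longrightarrow> \<exists>S\<subseteq>V1. e \<le> card S \<and>
        (\<forall>s\<in>S. \<exists>xs. path_in H V1 xs \<and> length xs = Suc k \<and> hd xs = s \<and> last xs = b)"
    using ex_expanding_reserve[OF finAB(1,4) _ symH joined_mono[OF jnH As(1) Bs(1)] As(4) Bs(4) e k k']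
      As(1) Bs(1) disj by blast
  obtain V2 where V2: "V2 \<subseteq> A2 \<union> B2" "e \<le> card (V2 \<inter> B2)"
    and S2: "\<And>b. b \<in> V2 \<Longrightarrow> \<exists>S\<subseteq>V2. e \<le> card S \<and>
        (\<forall>s\<in>S. \<exists>xs. path_in H V2 xs \<and> length xs = Suc k \<and> hd xs = s \<and> last xs = b)"
    using ex_expanding_reserve[OF finAB(2,5) _ symH joined_mono[OF jnH sub(1,3)] As(5) Bs(5) e k k']
      sub(1,3) disj by blast
  have alt: "x \<in> A \<longleftrightarrow> y \<notin> A" if "H x y" for x y using that disj by (auto simp: H_def)
  have altp: "xs ! i \<in> A \<longleftrightarrow> (xs ! 0 \<in> A \<longleftrightarrow> even i)" if "path_in H V xs" "i < length xs" for xs i V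
  proof -
    have "successively (\<lambda>x y. (x \<in> A) \<noteq> (y \<in> A)) xs"
      using that(1) alt unfolding path_in_def by (blast intro: successively_mono)
    then show ?thesis by (rule alternating_nth) (rule that(2))
  qed
  have "A3 \<inter> B3 = {}" using sub disj by blast
  then obtain p0 where p0: "path_in H (A3 \<union> B3) p0" "6 * e \<le> length p0"
    using joined_ex_long_path[OF finAB(3,6) _ symH joined_mono[OF jnH sub(2,4)], of "6 * e"]
      As(6) Bs(6) by auto
  \<comment> \<open>These vertices avoid all reserved parts and can be attached to the root of a
    tree in either reserve.\<close>
  define W where "W = (A - A1 - A2 - A3) \<inter> nbrs H (V1 \<inter> B1) \<inter> nbrs H (V2 \<inter> B2)"
  have "12 * e \<le> card W"
  proof -
    have non: "card (A - nbrs H (V \<inter> B')) < e" if "e \<le> card (V \<inter> B')" "B' \<subseteq> B" for V B'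
      using card_non_nbrs_less[OF joined_sym[OF jnH symH] _ that(1)] that(2) by blast
    have "A \<subseteq> W \<union> A1 \<union> A2 \<union> A3 \<union> (A - nbrs H (V1 \<inter> B1)) \<union> (A - nbrs H (V2 \<inter> B2))"
      unfolding W_def by blast
    then have "card A \<le> card (W \<union> A1 \<union> A2 \<union> A3 \<union> (A - nbrs H (V1 \<inter> B1)) \<union> (A - nbrs H (V2 \<inter> B2)))"
      using fin finAB by (intro card_mono) (auto simp: W_def)
    also have "\<dots> \<le> card W + card A1 + card A2 + card A3 + card (A - nbrs H (V1 \<inter> B1)) + card (A - nbrs H (V2 \<inter> B2))"
      by (intro order_trans[OF card_Un_le] add_mono order_refl)
    finally show ?thesis
      using A As non[OF V1(2) Bs(1)] non[OF V2(2) sub(3)] by linarith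
  qed
  moreover have "\<not> R a a'" if a: "a \<in> W" "a' \<in> W" for a a'
  proof
    assume aa: "R a a'"
    then have "a \<noteq> a'" using irr by (auto dest: irreflpD)
    obtain b where b: "b \<in> V1" "b \<in> B1" "H b a" using a unfolding W_def nbrs_def by blast
    obtain b' where b': "b' \<in> V2" "b' \<in> B2" "H b' a'" using a unfolding W_def nbrs_def by blast
    obtain S where S: "S \<subseteq> V1" "e \<le> card S"
      and SP: "\<And>s. s \<in> S \<Longrightarrow> \<exists>xs. path_in H V1 xs \<and> length xs = Suc k \<and> hd xs = s \<and> last xs = b"
      using S1[OF b(1)] by blast
    obtain S' where S': "S' \<subseteq> V2" "e \<le> card S'"
      and SP': "\<And>s. s \<in> S' \<Longrightarrow> \<exists>xs. path_in H V2 xs \<and> length xs = Suc k \<and> hd xs = s \<and> last xs = b'"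
      using S2[OF b'(1)] by blast
    have side: "s \<in> A \<longleftrightarrow> odd k"
      if "path_in H V xs" "length xs = Suc k" "hd xs = s" "last xs = c" "c \<in> B" for s c xs V
    proof -
      have "xs \<noteq> []" using that by auto
      then have "xs ! 0 = s" "xs ! k = c" using that by (auto simp: hd_conv_nth last_conv_nth)
      then show ?thesis using altp[OF that(1), of k] that disj by auto
    qed
    have bB: "b \<in> B" "b' \<in> B" using b b' Bs by auto
    have sS: "s \<in> A \<longleftrightarrow> odd k" if "s \<in> S" for s using SP[OF that] side bB by blast
    have sS': "s \<in> A \<longleftrightarrow> odd k" if "s \<in> S'" for s using SP'[OF that] side bB by blast
    \<comment> \<open>The roots \<open>b\<close>, \<open>b'\<close> lie in \<open>B\<close> and tree
      paths have \<open>k\<close> edges, so the leaves in \<open>S\<close> and \<open>S'\<close> lie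
      in \<open>A\<close> exactly for odd \<open>k\<close>. \<open>Q\<close> is the side opposite to
      them, where both ends of the linking subpath have to lie.\<close>
    define Q where "Q = (if odd k then B3 else A3)"
    have SAB: "S \<subseteq> A \<union> B" "S' \<subseteq> A \<union> B"
      using S S' V1 V2 As(1) Bs(1) sub by blast+
    have few: "card (Q - nbrs H T) < e" if T: "T \<subseteq> A \<union> B" "\<And>s. s \<in> T \<Longrightarrow> s \<in> A \<longleftrightarrow> odd k" "e \<le> card T" for T
    proof (cases "odd k")
      case True
      then have "T \<subseteq> A" using T by blast
      then show ?thesis using card_non_nbrs_less[OF joined_mono[OF jnH order_refl sub(4)] _ T(3)] True
        by (simp add: Q_def)
    next
      case False
      then have "T \<subseteq> B" using T by blast
      then show ?thesis
        using card_non_nbrs_less[OF joined_mono[OF joined_sym[OF jnH symH] order_refl sub(2)] _ T(3)] False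
        by (simp add: Q_def)
    qed
    \<comment> \<open>Dropping at most one vertex puts the even positions of the path into
      \<open>Q\<close>; this is paid for by the surplus of \<open>6 * e\<close> over
      \<open>5 * e\<close>.\<close>
    define p where "p = (if p0 ! 0 \<in> Q then p0 else tl p0)"
    have lp0: "1 < length p0" using p0(2) e by linarith
    then obtain y ys where p0y: "p0 = y # ys" "ys \<noteq> []" by (cases p0) auto
    have p: "path_in H (A3 \<union> B3) p" "5 * e \<le> length p"
      using p0 p0y e unfolding p_def path_in_def by (auto simp: successively_Cons)
    have Qiff: "x \<in> Q \<longleftrightarrow> (x \<in> A \<longleftrightarrow> even k)" if "x \<in> A3 \<union> B3" for x
      using that sub disj by (auto simp: Q_def)
    have inV: "p0 ! i \<in> A3 \<union> B3" if "i < length p0" for i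
      using p0(1) nth_mem[OF that] unfolding path_in_def by blast
    have "p ! 0 \<in> Q"
    proof (cases "p0 ! 0 \<in> Q")
      case False
      then have "p0 ! 1 \<in> Q"
        using altp[OF p0(1), of 1] lp0 p0y(1) Qiff[OF inV, of 0] Qiff[OF inV, of 1] by auto
      then show ?thesis using False lp0 by (simp add: p_def nth_tl)
    qed (simp add: p_def)
    then have pQ: "p ! i \<in> Q" if "i < length p" "even i" for i
    proof -
      have "p ! i \<in> A3 \<union> B3" "p ! 0 \<in> A3 \<union> B3" using p(1) that nth_mem[of _ p]
        unfolding path_in_def by (metis subsetD length_greater_0_conv list.size(3) not_less_zero)+
      then show ?thesis using altp[OF p(1) that(1)] that(2) Qiff \<open>p ! 0 \<in> Q\<close> by auto
    qed
    \<comment> \<open>The cycle consists of \<open>a\<close>, \<open>a'\<close>, two tree paths on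
      \<open>Suc k\<close> vertices each and the linking subpath, so the latter must have
      \<open>n - (2 * k + 4)\<close> vertices, an odd number.\<close>
    define t where "t = n - (2 * k + 4)"
    have nt: "n = 2 * k + 4 + t" "odd t" "t \<le> e"
      using n kn unfolding t_def by presburger+
    have "finite Q" using finAB by (simp add: Q_def)
    moreover have "card (Q - nbrs H S) < e" "card (Q - nbrs H S') < e"
      using few[OF SAB(1) sS S(2)] few[OF SAB(2) sS' S'(2)] by blast+
    ultimately obtain q where q: "path_in H (A3 \<union> B3) q" "length q = t"
        "hd q \<in> nbrs H S" "last q \<in> nbrs H S'"
      using ex_connecting_subpath[OF p nt(2,3), of Q S S'] pQ by blast
    obtain s where s: "s \<in> S" "H s (hd q)" using q(3) by (auto simp: nbrs_def)
    obtain s' where s': "s' \<in> S'" "H s' (last q)" using q(4) by (auto simp: nbrs_def)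
    obtain xs where xs: "path_in H V1 xs" "length xs = Suc k" "hd xs = s" "last xs = b"
      using SP[OF s(1)] by blast
    obtain xs' where xs': "path_in H V2 xs'" "length xs' = Suc k" "hd xs' = s'" "last xs' = b'"
      using SP'[OF s'(1)] by blast
    have ne: "xs \<noteq> []" "xs' \<noteq> []" "q \<noteq> []" using xs xs' q nt by auto
    have conv: "\<And>x y. H x y \<Longrightarrow> R x y \<and> R y x" using HR sym by (meson sympD)
    have suc: "successively R q" "successively R xs" "successively R xs'" "successively R (rev xs)"
      using q(1) xs(1) xs'(1) conv unfolding path_in_def
      by (auto simp: successively_rev intro: successively_mono)
    \<comment> \<open>The order is \<open>a\<close>, root \<open>b\<close> to leaf \<open>s\<close>,
      the subpath \<open>q\<close>, leaf \<open>s'\<close> to root \<open>b'\<close>, then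
      \<open>a'\<close>; the edge between \<open>a'\<close> and \<open>a\<close> closes the
      cycle.\<close>
    let ?c = "[a] @ rev xs @ q @ xs' @ [a']"
    have "length ?c = n" using xs xs' q nt by simp
    moreover have "successively R ?c"
      using suc ne conv b b' s s' xs xs'
      by (auto simp: successively_append_iff successively_Cons hd_rev last_rev)
    moreover have "distinct ?c"
    proof -
      have "set xs \<subseteq> A1 \<union> B1" "set xs' \<subseteq> A2 \<union> B2" "set q \<subseteq> A3 \<union> B3"
        using xs xs' q V1 V2 unfolding path_in_def by blast+
      moreover have "a \<in> A - A1 - A2 - A3" "a' \<in> A - A1 - A2 - A3" using a by (auto simp: W_def)
      moreover have "distinct xs" "distinct xs'" "distinct q"
        using xs xs' q unfolding path_in_def by blast+
      moreover have "(A1 \<union> B1) \<inter> (A2 \<union> B2) = {}" "(A1 \<union> B1) \<inter> (A3 \<union> B3) = {}" "(A2 \<union> B2) \<inter> (A3 \<union> B3) = {}"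
        "(A - A1 - A2 - A3) \<inter> (A1 \<union> B1 \<union> (A2 \<union> B2) \<union> (A3 \<union> B3)) = {}"
        using As(1-3) Bs(1-3) disj by blast+
      ultimately show ?thesis using \<open>a \<noteq> a'\<close> unfolding distinct_append set_append set_rev distinct_rev
        by (simp, blast)
    qed
    moreover have "R (last ?c) (hd ?c)" using aa sym by (auto dest: sympD)
    ultimately show False using nocyc unfolding has_cycle_def by blast
  qed
  moreover have "W \<subseteq> A" unfolding W_def by blast
  ultimately show ?thesis by blast
qed

section \<open>A sparse host in which large disjoint sets are joined\<close>

text \<open>Double counting: each pair of \<open>s\<close>-sets contributes once for every element
  of its product.\<close>

lemma sum_card_incidences:
  assumes "finite V" "finite F" "\<And>X Y. (X, Y) \<in> F \<Longrightarrow> X \<subseteq> V \<and> Y \<subseteq> V \<and> card X = s \<and> card Y = s"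
  shows "(\<Sum>(x, y)\<in>V \<times> V. card {(X, Y) \<in> F. x \<in> X \<and> y \<in> Y}) = s * s * card F"
proof -
  have "(\<Sum>(x, y)\<in>V \<times> V. card {(X, Y) \<in> F. x \<in> X \<and> y \<in> Y})
      = (\<Sum>z\<in>V \<times> V. card {P \<in> F. z \<in> fst P \<times> snd P})"
    by (intro sum.cong refl) (auto intro!: arg_cong[where f = card])
  also have "\<dots> = (\<Sum>P\<in>F. card {z \<in> V \<times> V. z \<in> fst P \<times> snd P})"
    using assms(1,2) by (intro sum_multicount_gen) auto
  also have "\<dots> = (\<Sum>P\<in>F. s * s)"
  proof (intro sum.cong refl)
    fix P assume "P \<in> F"
    then have P: "fst P \<subseteq> V" "snd P \<subseteq> V" "card (fst P) = s" "card (snd P) = s"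
      using assms(3)[of "fst P" "snd P"] by auto
    then have "{z \<in> V \<times> V. z \<in> fst P \<times> snd P} = fst P \<times> snd P" by auto
    then show "card {z \<in> V \<times> V. z \<in> fst P \<times> snd P} = s * s"
      using P by (simp add: card_cartesian_product)
  qed
  finally show ?thesis by simp
qed

text \<open>Some pair of vertices lies in at least the average fraction \<open>1 / q\<^sup>2\<close> of the pairs of sets that
  are not yet joined by an edge.\<close>

lemma greedy_edges:
  fixes q s :: nat
  assumes "finite V" "card V = q * s" "0 < s" "0 < q"
    and F: "\<And>X Y. (X, Y) \<in> F \<Longrightarrow> X \<subseteq> V \<and> Y \<subseteq> V \<and> card X = s \<and> card Y = s \<and> X \<inter> Y = {}"
  shows "\<exists>E \<subseteq> [V]\<^bsup>2\<^esup>. card E \<le> M \<and> finite E \<and>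
    real (card {(X, Y) \<in> F. \<forall>x\<in>X. \<forall>y\<in>Y. {x, y} \<notin> E}) \<le> (1 - 1 / (real q)\<^sup>2) ^ M * real (card F)"
proof (induction M)
  case 0
  then show ?case by (intro exI[of _ "{}"]) (auto simp: case_prod_beta')
next
  case (Suc M)
  then obtain E where E: "E \<subseteq> [V]\<^bsup>2\<^esup>" "card E \<le> M" "finite E"
    and c: "real (card {(X, Y) \<in> F. \<forall>x\<in>X. \<forall>y\<in>Y. {x, y} \<notin> E}) \<le> (1 - 1 / (real q)\<^sup>2) ^ M * real (card F)"
    by blast
  define F' where "F' = {(X, Y) \<in> F. \<forall>x\<in>X. \<forall>y\<in>Y. {x, y} \<notin> E}"
  have "F \<subseteq> Pow V \<times> Pow V" by (auto dest!: F)
  then have finF: "finite F" using \<open>finite V\<close> finite_subset by blast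
  then have finF': "finite F'" unfolding F'_def by (rule rev_finite_subset) auto
  have q1: "0 \<le> 1 - 1 / (real q)\<^sup>2" using \<open>0 < q\<close> by simp
  define g where "g = (\<lambda>(x, y). card {(X, Y) \<in> F'. x \<in> X \<and> y \<in> Y})"
  have sum: "sum g (V \<times> V) = s * s * card F'"
    unfolding g_def by (rule sum_card_incidences[OF \<open>finite V\<close> finF']) (auto simp: F'_def dest!: F)
  have "\<exists>z\<in>V \<times> V. card F' \<le> q * q * g z"
  proof (rule ccontr)
    assume "\<not> ?thesis"
    then have "q * q * g z < card F'" if "z \<in> V \<times> V" for z using that by (meson linorder_not_le)
    moreover have "V \<noteq> {}" using assms(2-4) by auto
    ultimately have "(\<Sum>z\<in>V \<times> V. q * q * g z) < (\<Sum>z\<in>V \<times> V. card F')"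
      using \<open>finite V\<close> by (intro sum_strict_mono) auto
    then have "q * q * (s * s * card F') < (q * s) * (q * s) * card F'"
      using assms(2) by (simp add: sum_distrib_left[symmetric] sum card_cartesian_product)
    then show False by (simp add: mult_ac)
  qed
  then obtain x y where xy: "x \<in> V" "y \<in> V" and gq: "card F' \<le> q * q * g (x, y)" by auto
  show ?case
  proof (cases "g (x, y) = 0")
    case True
    then have "card F' = 0" using gq by simp
    then show ?thesis using E q1 unfolding F'_def by (intro exI[of _ E]) auto
  next
    case False
    then have "{(X, Y) \<in> F'. x \<in> X \<and> y \<in> Y} \<noteq> {}" unfolding g_def by (metis card.empty case_prod_conv)
    then have "x \<noteq> y" using F unfolding F'_def by blast
    define E' where "E' = insert {x, y} E"
    have E': "E' \<subseteq> [V]\<^bsup>2\<^esup>" "finite E'" "card E' \<le> Suc M"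
      using E xy \<open>x \<noteq> y\<close> unfolding E'_def by (auto simp: card_insert_if)
    let ?G = "{(X, Y) \<in> F'. x \<in> X \<and> y \<in> Y}"
    have "card {(X, Y) \<in> F. \<forall>x\<in>X. \<forall>y\<in>Y. {x, y} \<notin> E'} \<le> card (F' - ?G)"
      using finF' by (intro card_mono) (auto simp: F'_def E'_def)
    also have "card (F' - ?G) = card F' - g (x, y)"
      using finF' unfolding g_def by (subst card_Diff_subset) (auto intro: rev_finite_subset)
    finally have "card {(X, Y) \<in> F. \<forall>x\<in>X. \<forall>y\<in>Y. {x, y} \<notin> E'} \<le> card F' - g (x, y)" .
    moreover have "g (x, y) \<le> card F'" unfolding g_def using finF' by (auto intro: card_mono)
    ultimately have "real (card {(X, Y) \<in> F. \<forall>x\<in>X. \<forall>y\<in>Y. {x, y} \<notin> E'}) \<le> real (card F') - real (g (x, y))"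
      by linarith
    also have "\<dots> \<le> real (card F') - real (card F') / (real q)\<^sup>2"
    proof -
      have "real (card F') \<le> (real q)\<^sup>2 * real (g (x, y))"
        using gq by (metis of_nat_le_iff of_nat_mult power2_eq_square)
      then show ?thesis using \<open>0 < q\<close> by (simp add: divide_le_eq mult.commute)
    qed
    also have "\<dots> = (1 - 1 / (real q)\<^sup>2) * real (card F')" by (simp add: algebra_simps)
    also have "\<dots> \<le> (1 - 1 / (real q)\<^sup>2) * ((1 - 1 / (real q)\<^sup>2) ^ M * real (card F))"
      using c q1 unfolding F'_def by (intro mult_left_mono) auto
    finally show ?thesis using E' by (intro exI[of _ E']) (auto simp: mult.assoc)
  qed
qed

text \<open>Larger sets contain \<open>s\<close>-sets, and there are at most
  \<open>2 ^ (2 * N)\<close> pairs of those. Each block of \<open>q\<^sup>2\<close> greedy edges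
  multiplies the bound on the number of unjoined pairs by at most
  \<open>exp (- 1) \<le> 1 / 2\<close>, so after \<open>2 * N + 1\<close> blocks the bound is below
  one.\<close>

lemma ex_sparse_joined_graph:
  fixes q s :: nat
  assumes "finite V" "card V = q * s" "0 < s" "0 < q"
  shows "\<exists>E \<subseteq> [V]\<^bsup>2\<^esup>. card E \<le> q\<^sup>2 * (2 * card V + 1) \<and>
    (\<forall>X\<subseteq>V. \<forall>Y\<subseteq>V. X \<inter> Y = {} \<longrightarrow> s \<le> card X \<longrightarrow> s \<le> card Y \<longrightarrow> (\<exists>x\<in>X. \<exists>y\<in>Y. {x, y} \<in> E))"
proof -
  define F where "F = {(X, Y). X \<subseteq> V \<and> Y \<subseteq> V \<and> card X = s \<and> card Y = s \<and> X \<inter> Y = {}}"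
  define N where "N = card V"
  obtain E where E: "E \<subseteq> [V]\<^bsup>2\<^esup>" "card E \<le> q\<^sup>2 * (2 * N + 1)"
    and c: "real (card {(X, Y) \<in> F. \<forall>x\<in>X. \<forall>y\<in>Y. {x, y} \<notin> E})
      \<le> (1 - 1 / (real q)\<^sup>2) ^ (q\<^sup>2 * (2 * N + 1)) * real (card F)"
    using greedy_edges[OF assms, of F "q\<^sup>2 * (2 * N + 1)"] unfolding F_def by auto
  let ?B = "{(X, Y) \<in> F. \<forall>x\<in>X. \<forall>y\<in>Y. {x, y} \<notin> E}"
  have FP: "F \<subseteq> Pow V \<times> Pow V" by (auto simp: F_def)
  have finF: "finite F" using FP \<open>finite V\<close> finite_subset by blast
  have "card F \<le> card (Pow V \<times> Pow V)" using FP \<open>finite V\<close> by (intro card_mono) auto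
  also have "\<dots> = 2 ^ (2 * N)"
    using \<open>finite V\<close> by (simp add: card_cartesian_product card_Pow N_def power_add[symmetric] mult_2)
  finally have cF: "real (card F) \<le> 2 ^ (2 * N)" by (metis of_nat_le_iff of_nat_numeral of_nat_power)
  have half: "(1 - 1 / (real q)\<^sup>2) ^ (q\<^sup>2) \<le> 1 / 2"
  proof -
    have "1 - 1 / (real q)\<^sup>2 \<le> exp (- (1 / (real q)\<^sup>2))"
      using exp_ge_add_one_self[of "- (1 / (real q)\<^sup>2)"] by simp
    then have "(1 - 1 / (real q)\<^sup>2) ^ (q\<^sup>2) \<le> exp (- (1 / (real q)\<^sup>2)) ^ (q\<^sup>2)"
      using \<open>0 < q\<close> by (intro power_mono) auto
    also have "\<dots> = exp (- 1)"
      using \<open>0 < q\<close> by (simp add: exp_of_nat_mult[symmetric])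
    also have "\<dots> \<le> 1 / 2"
      using exp_ge_add_one_self[of 1] by (simp add: exp_minus inverse_eq_divide divide_simps)
    finally show ?thesis .
  qed
  have "real (card ?B) \<le> ((1 - 1 / (real q)\<^sup>2) ^ (q\<^sup>2)) ^ (2 * N + 1) * real (card F)"
    using c by (simp only: power_mult)
  also have "\<dots> \<le> (1 / 2) ^ (2 * N + 1) * 2 ^ (2 * N)"
    using half cF \<open>0 < q\<close> by (intro mult_mono power_mono) auto
  also have "\<dots> < 1" by (simp add: power_divide)
  finally have "card ?B = 0" by simp
  moreover have "finite ?B" using finF by (rule rev_finite_subset) auto
  ultimately have B: "?B = {}" by simp
  have "\<exists>x\<in>X. \<exists>y\<in>Y. {x, y} \<in> E"
    if XY: "X \<subseteq> V" "Y \<subseteq> V" "X \<inter> Y = {}" "s \<le> card X" "s \<le> card Y" for X Y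
  proof -
    obtain X' where X': "X' \<subseteq> X" "card X' = s" using XY(4) by (meson obtain_subset_with_card_n)
    obtain Y' where Y': "Y' \<subseteq> Y" "card Y' = s" using XY(5) by (meson obtain_subset_with_card_n)
    have "(X', Y') \<in> F" using X' Y' XY by (auto simp: F_def)
    then show ?thesis using B X' Y' by blast
  qed
  then show ?thesis using E unfolding N_def by (intro exI[of _ E]) simp
qed

section \<open>Colour classes as relations, and the complete host\<close>

definition colour_adj :: "'a set set \<Rightarrow> ('a set \<Rightarrow> nat) \<Rightarrow> nat \<Rightarrow> 'a \<Rightarrow> 'a \<Rightarrow> bool" where
  "colour_adj E \<chi> c x y \<longleftrightarrow> {x, y} \<in> E \<and> \<chi> {x, y} = c"

lemma symp_colour_adj: "symp (colour_adj E \<chi> c)"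
  by (auto simp: symp_def colour_adj_def insert_commute)

lemma irreflp_colour_adj: "E \<subseteq> [V]\<^bsup>2\<^esup> \<Longrightarrow> irreflp (colour_adj E \<chi> c)"
  by (auto simp: irreflp_def colour_adj_def nsets_def)

text \<open>The embedding is indexing into the vertex list; \<open>Suc i mod n\<close> wraps around
  exactly at the closing pair.\<close>

lemma has_cycle_imp_has_mono_copy:
  assumes "has_cycle (colour_adj E \<chi> c) n" "E \<subseteq> [V]\<^bsup>2\<^esup>" "0 < n"
  shows "has_mono_copy (cycle_graph n) (V, E) \<chi> c"
proof -
  obtain xs where xs: "length xs = n" "distinct xs" "successively (colour_adj E \<chi> c) xs"
    "colour_adj E \<chi> c (last xs) (hd xs)"
    using assms(1) unfolding has_cycle_def by blast
  have ne: "xs \<noteq> []" using xs assms(3) by auto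
  have adj: "colour_adj E \<chi> c (xs ! i) (xs ! (Suc i mod n))" if "i < n" for i
  proof (cases "Suc i = n")
    case True
    then have "last xs = xs ! i" using ne xs(1) by (auto simp: last_conv_nth)
    then show ?thesis using xs(4) ne True by (simp add: hd_conv_nth)
  next
    case False
    then show ?thesis using xs that by (simp add: successively_conv_nth)
  qed
  have "xs ! i \<in> V" if "i < n" for i
    using adj[OF that] assms(2) by (auto simp: colour_adj_def nsets_def)
  then show ?thesis
    unfolding has_mono_copy_def cycle_graph_def using xs adj
    by (intro exI[of _ "(!) xs"]) (auto simp: inj_on_nth colour_adj_def)
qed

lemma size_ramsey_cycle_le:
  fixes E :: "nat set set"
  assumes "finite V" "E \<subseteq> [V]\<^bsup>2\<^esup>" "0 < n"
    and "\<And>\<chi>. \<chi> \<in> E \<rightarrow> {..<r} \<Longrightarrow> \<exists>c<r. has_cycle (colour_adj E \<chi> c) n"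
  shows "size_ramsey (cycle_graph n) r \<le> card E"
proof -
  have "simple_graph (V, E)" using assms by (simp add: simple_graph_def)
  moreover have "ramsey_graph (V, E) (cycle_graph n) r"
    unfolding ramsey_graph_def using assms(4) has_cycle_imp_has_mono_copy[OF _ assms(2,3)] by fastforce
  moreover have "card (edges (V, E)) = card E" by simp
  ultimately show ?thesis unfolding size_ramsey_def by (intro Least_le) blast
qed

text \<open>The neighbourhood of a vertex in its most frequent colour \<open>c\<close> contains no path of colour \<open>c\<close>
  on \<open>n - 1\<close> vertices, hence a large set avoiding \<open>c\<close>.\<close>

lemma complete_no_cycle_card_le:
  assumes "3 \<le> n" "E \<subseteq> [V]\<^bsup>2\<^esup>"
  shows "finite J \<Longrightarrow> card J = m \<Longrightarrow> m \<le> r \<Longrightarrow> finite U \<Longrightarrow> [U]\<^bsup>2\<^esup> \<subseteq> E \<Longrightarrow> \<chi> ` [U]\<^bsup>2\<^esup> \<subseteq> J \<Longrightarrow>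
    (\<And>c. c \<in> J \<Longrightarrow> \<not> has_cycle (colour_adj E \<chi> c) n) \<Longrightarrow> card U \<le> (r * n) ^ m"
proof (induction m arbitrary: J U)
  case 0
  then have "x = y" if "x \<in> U" "y \<in> U" for x y
    using that by (metis card_0_eq empty_iff image_subset_iff doubleton_in_nsets_2)
  then show ?case using 0 by (simp add: card_le_Suc0_iff_eq)
next
  case (Suc m)
  show ?case
  proof (rule ccontr)
    assume big: "\<not> ?thesis"
    let ?b = "(r * n) ^ m"
    let ?R = "colour_adj E \<chi>"
    obtain v where v: "v \<in> U" using big by fastforce
    define X where "X c = {x \<in> U. ?R c v x}" for c
    have finX: "finite (X c)" for c using Suc.prems(4) by (simp add: X_def)
    \<comment> \<open>Above this threshold \<open>ex_path_or_independent\<close> gives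
      \<open>Suc (n - 2)\<close> vertices once independent sets have at most \<open>?b\<close>
      elements; \<open>v\<close> is the missing \<open>n\<close>-th vertex.\<close>
    have "\<exists>c\<in>J. (n - 2) * ?b < card (X c)"
    proof (rule ccontr)
      assume no: "\<not> ?thesis"
      have "U - {v} \<subseteq> (\<Union>c\<in>J. X c)"
      proof
        fix x assume x: "x \<in> U - {v}"
        then have "{v, x} \<in> [U]\<^bsup>2\<^esup>" using v by auto
        then show "x \<in> (\<Union>c\<in>J. X c)"
          using x Suc.prems(5,6) by (auto simp: X_def colour_adj_def)
      qed
      then have "card (U - {v}) \<le> card (\<Union>c\<in>J. X c)"
        using finX Suc.prems(1) by (intro card_mono) auto
      also have "\<dots> \<le> (\<Sum>c\<in>J. card (X c))" using Suc.prems(1) by (rule card_UN_le)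
      also have "\<dots> \<le> (\<Sum>c\<in>J. (n - 2) * ?b)" using no by (intro sum_mono) auto
      also have "\<dots> \<le> r * ((n - 2) * ?b)" using Suc.prems(2,3) by (simp del: mult_Suc)
      finally have "card (U - {v}) \<le> r * ((n - 2) * ?b)" .
      moreover have "r * n * ?b \<le> card (U - {v})" using big v Suc.prems(4) by simp
      moreover have "r * ((n - 2) * ?b) < r * n * ?b"
        using Suc.prems(2,3) \<open>3 \<le> n\<close> by simp
      ultimately show False by linarith
    qed
    then obtain c where c: "c \<in> J" "(n - 2) * ?b < card (X c)" by blast
    have "\<exists>xs. path_in (?R c) (X c) xs \<and> length xs = Suc (n - 2)"
    proof (rule ex_path_or_independent[OF finX c(2) _ symp_colour_adj irreflp_colour_adj[OF assms(2)]])
      fix I assume I: "I \<subseteq> X c" "\<forall>x\<in>I. \<forall>y\<in>I. \<not> ?R c x y"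
      have IU: "I \<subseteq> U" using I by (auto simp: X_def)
      then have IU2: "[I]\<^bsup>2\<^esup> \<subseteq> [U]\<^bsup>2\<^esup>" by (rule nsets_mono)
      have "\<chi> f \<in> J - {c}" if f: "f \<in> [I]\<^bsup>2\<^esup>" for f
      proof -
        have "f \<in> E" "\<chi> f \<in> J" using f IU2 Suc.prems(5,6) by auto
        moreover have "\<chi> f \<noteq> c" using f I(2) \<open>f \<in> E\<close> by (auto elim!: nsets2_E simp: colour_adj_def)
        ultimately show ?thesis by blast
      qed
      then show "card I \<le> ?b"
        using Suc.IH[of "J - {c}" I] Suc.prems c(1) IU IU2 finite_subset[OF IU]
        by (auto simp: image_subset_iff)
    qed
    then obtain xs where xs: "path_in (?R c) (X c) xs" "length xs = Suc (n - 2)" by blast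
    have ne: "xs \<noteq> []" using xs by auto
    have sub: "set xs \<subseteq> X c" using xs by (simp add: path_in_def)
    have irr: "\<not> ?R c v v" using irreflp_colour_adj[OF assms(2)] by (metis irreflpD)
    have "v \<notin> set xs" using sub irr unfolding X_def by auto
    moreover have "?R c v (hd xs)" "?R c v (last xs)"
      using subsetD[OF sub hd_in_set[OF ne]] subsetD[OF sub last_in_set[OF ne]] unfolding X_def by auto
    ultimately have "has_cycle (?R c) n"
      unfolding has_cycle_def using xs ne \<open>3 \<le> n\<close> sympD[OF symp_colour_adj]
      by (intro exI[of _ "v # xs"]) (auto simp: path_in_def successively_Cons)
    then show False using Suc.prems(7) c by blast
  qed
qed

section \<open>Elimination of colours in the sparse host\<close>

text \<open>If colour \<open>c\<close> has a hole at scale \<open>e = 64 ^ card J * M\<close>, the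
  two sides of the hole inherit the hypotheses with \<open>c\<close> deleted. When no colours are
  left, both sides still have at least \<open>s\<close> vertices, and the host edge between them has
  no colour. The ratio \<open>64\<close> between set size and scale is the one needed by
  \<open>joined_pair_cycle_or_independent\<close>.\<close>

lemma ex_joined_colour:
  assumes host: "\<And>X Y. X \<subseteq> V \<Longrightarrow> Y \<subseteq> V \<Longrightarrow> X \<inter> Y = {} \<Longrightarrow> s \<le> card X \<Longrightarrow> s \<le> card Y \<Longrightarrow> \<exists>x\<in>X. \<exists>y\<in>Y. {x, y} \<in> E"
    and "s \<le> M"
  shows "finite J \<Longrightarrow> A \<subseteq> V \<Longrightarrow> B \<subseteq> V \<Longrightarrow> A \<inter> B = {} \<Longrightarrow>
    64 ^ card J * M \<le> card A \<Longrightarrow> 64 ^ card J * M \<le> card B \<Longrightarrow>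
    (\<And>x y. x \<in> A \<Longrightarrow> y \<in> B \<Longrightarrow> {x, y} \<in> E \<Longrightarrow> \<chi> {x, y} \<in> J) \<Longrightarrow>
    \<exists>c\<in>J. \<exists>e A' B'. M \<le> e \<and> A' \<subseteq> A \<and> B' \<subseteq> B \<and> joined (colour_adj E \<chi> c) A' B' e \<and>
      64 * e \<le> card A' \<and> 64 * e \<le> card B'"
proof (induction J arbitrary: A B rule: finite_induct)
  case empty
  then show ?case using host[of A B] \<open>s \<le> M\<close> by force
next
  case (insert c J)
  define e where "e = 64 ^ card J * M"
  have e: "64 * e \<le> card A" "64 * e \<le> card B" "M \<le> e"
    using insert.prems insert.hyps by (auto simp: e_def)
  show ?case
  proof (cases "joined (colour_adj E \<chi> c) A B e")
    case True
    then show ?thesis using e by blast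
  next
    case False
    then obtain X Y where XY: "X \<subseteq> A" "Y \<subseteq> B" "e \<le> card X" "e \<le> card Y"
      and no: "\<And>x y. x \<in> X \<Longrightarrow> y \<in> Y \<Longrightarrow> \<not> colour_adj E \<chi> c x y"
      unfolding joined_def by blast
    have "\<chi> {x, y} \<in> J" if "x \<in> X" "y \<in> Y" "{x, y} \<in> E" for x y
    proof -
      have "\<chi> {x, y} \<in> insert c J" using insert.prems(6)[of x y] that XY by blast
      then show ?thesis using no[OF that(1,2)] that(3) by (auto simp: colour_adj_def)
    qed
    moreover have "X \<subseteq> V" "Y \<subseteq> V" "X \<inter> Y = {}" using XY insert.prems by blast+
    ultimately have "\<exists>c\<in>J. \<exists>e A' B'. M \<le> e \<and> A' \<subseteq> X \<and> B' \<subseteq> Y \<and> joined (colour_adj E \<chi> c) A' B' e \<and>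
      64 * e \<le> card A' \<and> 64 * e \<le> card B'"
      using insert.IH[of X Y] XY unfolding e_def by blast
    then show ?thesis using XY by (meson insertI2 subset_trans)
  qed
qed

text \<open>A colour joined at some scale \<open>e \<ge> M\<close> is absent from a set
  \<open>W\<close> of at least \<open>12 * e\<close> vertices, on which induction applies. The
  exponent \<open>f m = 3 * m\<^sup>2 + 4 * m + 1\<close> solves
  \<open>f (Suc m) = f m + 1 + 6 * Suc m\<close>: one for halving, and \<open>6 * Suc m\<close> for
  \<open>64 ^ Suc m\<close>. The value \<open>f 0 = 1\<close> leaves room for two disjoint
  \<open>n\<close>-sets at the end.\<close>

lemma sparse_no_cycle_False:
  assumes host: "\<And>X Y. X \<subseteq> V \<Longrightarrow> Y \<subseteq> V \<Longrightarrow> X \<inter> Y = {} \<Longrightarrow> n \<le> card X \<Longrightarrow> n \<le> card Y \<Longrightarrow> \<exists>x\<in>X. \<exists>y\<in>Y. {x, y} \<in> E"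
    and E: "E \<subseteq> [V]\<^bsup>2\<^esup>" and "finite V" and n: "odd n" "5 \<le> n" "card V \<le> 2 ^ ((n - 5) div 2)"
  shows "finite J \<Longrightarrow> card J = m \<Longrightarrow> U \<subseteq> V \<Longrightarrow> 2 ^ (3 * m\<^sup>2 + 4 * m + 1) * n \<le> card U \<Longrightarrow>
    (\<And>x y. x \<in> U \<Longrightarrow> y \<in> U \<Longrightarrow> {x, y} \<in> E \<Longrightarrow> \<chi> {x, y} \<in> J) \<Longrightarrow>
    (\<And>c. c \<in> J \<Longrightarrow> \<not> has_cycle (colour_adj E \<chi> c) n) \<Longrightarrow> False"
proof (induction m arbitrary: J U)
  case 0
  then have "n \<le> card U" by simp
  then obtain A where A: "A \<subseteq> U" "card A = n" "finite A" by (rule obtain_subset_with_card_n)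
  have "n \<le> card (U - A)" using diff_card_le_card_Diff[OF A(3), of U] 0 A by simp
  then obtain x y where "x \<in> A" "y \<in> U - A" "{x, y} \<in> E"
    using host[of A "U - A"] A 0 by blast
  then show False using 0 A by auto
next
  case (Suc m)
  define M where "M = 2 ^ (3 * m\<^sup>2 + 4 * m + 1) * n"
  have "(64 :: nat) = 2 ^ 6" by simp
  then have "(64 :: nat) ^ Suc m = 2 ^ (6 * Suc m)" by (metis power_mult)
  then have "2 * (64 ^ Suc m * M) = 2 ^ (1 + 6 * Suc m + (3 * m\<^sup>2 + 4 * m + 1)) * n"
    unfolding M_def by (simp only: power_add power_one_right mult.assoc)
  also have "1 + 6 * Suc m + (3 * m\<^sup>2 + 4 * m + 1) = 3 * (Suc m)\<^sup>2 + 4 * Suc m + 1"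
    by (simp add: power2_eq_square)
  finally have U: "2 * (64 ^ Suc m * M) \<le> card U" using Suc.prems(4) by simp
  then obtain A where A: "A \<subseteq> U" "card A = 64 ^ Suc m * M" "finite A"
    using obtain_subset_with_card_n[of "64 ^ Suc m * M" U] by auto
  have B: "64 ^ Suc m * M \<le> card (U - A)" using diff_card_le_card_Diff[OF A(3), of U] A U by linarith
  have nM: "n \<le> M" by (simp add: M_def)
  have "\<exists>c\<in>J. \<exists>e A' B'. M \<le> e \<and> A' \<subseteq> A \<and> B' \<subseteq> U - A \<and> joined (colour_adj E \<chi> c) A' B' e \<and>
      64 * e \<le> card A' \<and> 64 * e \<le> card B'"
  proof (rule ex_joined_colour[OF host nM])
    show "finite J" "A \<subseteq> V" "U - A \<subseteq> V" "A \<inter> (U - A) = {}" using Suc.prems A by auto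
    show "64 ^ card J * M \<le> card A" "64 ^ card J * M \<le> card (U - A)" using Suc.prems(2) A B by auto
    show "\<chi> {x, y} \<in> J" if "x \<in> A" "y \<in> U - A" "{x, y} \<in> E" for x y
      using that A Suc.prems(5) by blast
  qed
  then obtain c e A' B' where c: "c \<in> J" "M \<le> e" "A' \<subseteq> A" "B' \<subseteq> U - A"
    "joined (colour_adj E \<chi> c) A' B' e" "64 * e \<le> card A'" "64 * e \<le> card B'" by blast
  have AV: "A' \<subseteq> V" "B' \<subseteq> V" using c A Suc.prems(3) by blast+
  then have fin: "finite A'" "finite B'" using \<open>finite V\<close> finite_subset by auto
  have "card A' \<le> card V" using AV \<open>finite V\<close> by (simp add: card_mono)
  \<comment> \<open>The host has at most \<open>2 ^ ((n - 5) div 2)\<close> vertices, so trees with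
    \<open>2 * e\<close> leaves are shallow enough to fit into a cycle on \<open>n\<close>
    vertices.\<close>
  then have e2: "2 * e \<le> 2 ^ ((n - 5) div 2)" using c n(3) by linarith
  have "A' \<inter> B' = {}" using c by blast
  then obtain W where W: "W \<subseteq> A'" "12 * e \<le> card W" "\<forall>x\<in>W. \<forall>y\<in>W. \<not> colour_adj E \<chi> c x y"
    using joined_pair_cycle_or_independent[OF fin _ symp_colour_adj irreflp_colour_adj[OF E] c(5-7) n(1,2) _ e2]
      Suc.prems(6)[OF c(1)] nM c(2) by force
  have "W \<subseteq> U" using W c A by blast
  show False
  proof (rule Suc.IH[of "J - {c}" W])
    show "finite (J - {c})" "card (J - {c}) = m" using Suc.prems(1,2) c(1) by auto
    show "W \<subseteq> V" using W AV by blast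
    show "2 ^ (3 * m\<^sup>2 + 4 * m + 1) * n \<le> card W" using W c(2) unfolding M_def[symmetric] by linarith
    show "\<chi> {x, y} \<in> J - {c}" if "x \<in> W" "y \<in> W" "{x, y} \<in> E" for x y
      using that W(3) Suc.prems(5)[of x y] \<open>W \<subseteq> U\<close> by (auto simp: colour_adj_def)
    show "\<not> has_cycle (colour_adj E \<chi> d) n" if "d \<in> J - {c}" for d
      using that Suc.prems(6) by blast
  qed
qed

section \<open>Numerical bounds and conclusion\<close>

text \<open>The host is complete on \<open>(r * n) ^ r + 1\<close> vertices. Since
  \<open>r * n \<le> 2 ^ (5 * r)\<close>, this is at most \<open>2 * 2 ^ (5 * r\<^sup>2)\<close>,
  and the square bounds the number of edges.\<close>

lemma size_ramsey_cycle_small: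
  assumes "2 \<le> r" "3 \<le> n" "n < 2 ^ (4 * r)"
  shows "size_ramsey (cycle_graph n) r \<le> 4 * 2 ^ (10 * r\<^sup>2)"
proof -
  define N where "N = (r * n) ^ r + 1"
  define V where "V = {..<N}"
  have "size_ramsey (cycle_graph n) r \<le> card ([V]\<^bsup>2\<^esup>)"
  proof (rule size_ramsey_cycle_le[where V = V])
    fix \<chi> assume chi: "\<chi> \<in> [V]\<^bsup>2\<^esup> \<rightarrow> {..<r}"
    show "\<exists>c<r. has_cycle (colour_adj ([V]\<^bsup>2\<^esup>) \<chi> c) n"
    proof (rule ccontr)
      assume "\<not> ?thesis"
      then have "card V \<le> (r * n) ^ r"
        using chi by (intro complete_no_cycle_card_le[OF assms(2) order_refl, of "{..<r}"])
          (auto simp: V_def)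
      then show False by (simp add: V_def N_def)
    qed
  qed (use assms in \<open>auto simp: V_def\<close>)
  also have "\<dots> = N choose 2" by (simp add: card_nsets V_def)
  also have "\<dots> \<le> N ^ 2" using assms by (intro binomial_le_pow) (simp add: N_def Suc_le_eq)
  also have "\<dots> \<le> (2 * 2 ^ (5 * r\<^sup>2)) ^ 2"
  proof (rule power_mono)
    have "r < 2 ^ r" by (rule less_exp)
    then have "r * n \<le> 2 ^ r * 2 ^ (4 * r)" using assms by (intro mult_le_mono) auto
    then have "(r * n) ^ r \<le> (2 ^ r * 2 ^ (4 * r)) ^ r" by (rule power_mono) simp
    also have "\<dots> = 2 ^ (5 * r\<^sup>2)"
      by (simp add: power_add[symmetric] power_mult[symmetric] power2_eq_square)
    finally have "N \<le> 2 ^ (5 * r\<^sup>2) + 1" unfolding N_def by simp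
    also have "\<dots> \<le> 2 * 2 ^ (5 * r\<^sup>2)" by (simp add: mult_2 Suc_le_eq)
    finally show "N \<le> 2 * 2 ^ (5 * r\<^sup>2)" .
  qed simp
  also have "\<dots> = 4 * 2 ^ (10 * r\<^sup>2)"
    by (simp add: power_mult_distrib power_mult[symmetric])
  finally show ?thesis .
qed

text \<open>For \<open>n \<ge> 2 ^ (4 * r)\<close> both factors on the left are at most
  \<open>2 ^ (n div 8)\<close>, and \<open>2 * (n div 8) \<le> (n - 5) div 2\<close>.\<close>

lemma exp_large_cycle_bound:
  assumes "2 \<le> r" "2 ^ (4 * r) \<le> n"
  shows "2 ^ (3 * r\<^sup>2 + 4 * r + 1) * n \<le> (2 :: nat) ^ ((n - 5) div 2)"
proof -
  have "8 * (3 * r\<^sup>2 + 4 * r + 1) \<le> (2 :: nat) ^ (4 * r)"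
    using assms(1)
  proof (induction r rule: dec_induct)
    case (step r)
    have "r * 2 \<le> r\<^sup>2" using step by (simp add: power2_eq_square)
    then have "8 * (3 * (Suc r)\<^sup>2 + 4 * Suc r + 1) \<le> 16 * (8 * (3 * r\<^sup>2 + 4 * r + 1))"
      by (simp add: power2_eq_square)
    also have "\<dots> \<le> 16 * 2 ^ (4 * r)" using step by linarith
    also have "\<dots> = 2 ^ (4 * Suc r)" by (simp add: power_add)
    finally show ?case .
  qed simp
  then have l: "3 * r\<^sup>2 + 4 * r + 1 \<le> n div 8"
    using assms(2) by (simp add: less_eq_div_iff_mult_less_eq mult.commute del: distrib_left_numeral)
  have "(2 :: nat) ^ 8 \<le> 2 ^ (4 * r)" using assms(1) by (intro power_increasing) auto
  then have n: "256 \<le> n" using assms(2) by simp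
  then have "7 \<le> n div 8" by linarith
  moreover have "8 * (l + 1) \<le> (2 :: nat) ^ l" if "7 \<le> l" for l
    using that by (induction l rule: dec_induct) auto
  ultimately have "8 * (n div 8 + 1) \<le> (2 :: nat) ^ (n div 8)" by blast
  moreover have "n \<le> 8 * (n div 8 + 1)" by presburger
  ultimately have "n \<le> 2 ^ (n div 8)" by linarith
  then have "2 ^ (3 * r\<^sup>2 + 4 * r + 1) * n \<le> (2 :: nat) ^ (n div 8) * 2 ^ (n div 8)"
    using l by (intro mult_le_mono power_increasing) auto
  also have "\<dots> = 2 ^ (2 * (n div 8))" by (simp add: power_add[symmetric] mult_2)
  also have "\<dots> \<le> 2 ^ ((n - 5) div 2)" using n by (intro power_increasing) auto
  finally show ?thesis .
qed

text \<open>The host has \<open>q * n\<close> vertices and at most \<open>3 * q ^ 3 * n\<close>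
  edges; the \<open>+ 1\<close> in the exponent of \<open>q\<close> turns into the factor
  \<open>8\<close> of \<open>24 = 3 * 8\<close>.\<close>

lemma size_ramsey_cycle_large:
  assumes "2 \<le> r" "odd n" "2 ^ (4 * r) \<le> n"
  shows "size_ramsey (cycle_graph n) r \<le> 24 * 2 ^ (9 * r\<^sup>2 + 12 * r) * n"
proof -
  define q :: nat where "q = 2 ^ (3 * r\<^sup>2 + 4 * r + 1)"
  define V where "V = {..<q * n}"
  have "(2 :: nat) ^ 8 \<le> 2 ^ (4 * r)" using assms(1) by (intro power_increasing) auto
  then have n: "5 \<le> n" using assms(3) by simp
  have q: "0 < q" by (simp add: q_def)
  have V: "finite V" "card V = q * n" by (simp_all add: V_def)
  obtain E where E: "E \<subseteq> [V]\<^bsup>2\<^esup>" "card E \<le> q\<^sup>2 * (2 * card V + 1)"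
    and host: "\<And>X Y. X \<subseteq> V \<Longrightarrow> Y \<subseteq> V \<Longrightarrow> X \<inter> Y = {} \<Longrightarrow> n \<le> card X \<Longrightarrow> n \<le> card Y \<Longrightarrow> \<exists>x\<in>X. \<exists>y\<in>Y. {x, y} \<in> E"
    using ex_sparse_joined_graph[OF V _ q] n by auto
  have bound: "card V \<le> 2 ^ ((n - 5) div 2)"
    using exp_large_cycle_bound[OF assms(1,3)] V by (simp add: q_def)
  have "size_ramsey (cycle_graph n) r \<le> card E"
  proof (rule size_ramsey_cycle_le[OF V(1) E(1)])
    fix \<chi> assume chi: "\<chi> \<in> E \<rightarrow> {..<r}"
    show "\<exists>c<r. has_cycle (colour_adj E \<chi> c) n"
    proof (rule ccontr)
      assume no: "\<not> ?thesis"
      show False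
        by (rule sparse_no_cycle_False[OF host E(1) V(1) assms(2) n bound, of "{..<r}" r V \<chi>])
          (use no chi V in \<open>auto simp: q_def\<close>)
    qed
  qed (use n in simp)
  also have "\<dots> \<le> q\<^sup>2 * (2 * (q * n) + 1)" using E(2) V(2) by simp
  also have "\<dots> \<le> q\<^sup>2 * (3 * (q * n))" using q n by (intro mult_le_mono) (auto simp: Suc_le_eq)
  also have "\<dots> = 3 * q ^ 3 * n" by (simp add: power2_eq_square power3_eq_cube)
  also have "q ^ 3 = 2 ^ (9 * r\<^sup>2 + 12 * r + 3)"
    unfolding q_def power_mult[symmetric] by (simp add: algebra_simps)
  finally show ?thesis by (simp add: power_add)
qed

theorem theorem4p5:
  shows "\<exists>C::real. C > 0 \<and>
    (\<forall>r n :: nat. r \<ge> 2 \<longrightarrow> odd n \<longrightarrow> n \<ge> 3 \<longrightarrow>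
      real (size_ramsey (cycle_graph n) r) \<le> C * real r ^ 2 * 2 ^ (16 * r ^ 2) * real n)"
proof (intro exI[of _ 24] conjI allI impI)
  fix r n :: nat
  assume r: "r \<ge> 2" and n: "odd n" "n \<ge> 3"
  have "size_ramsey (cycle_graph n) r \<le> 24 * 2 ^ (16 * r\<^sup>2) * n"
  proof (cases "n < 2 ^ (4 * r)")
    case True
    have "size_ramsey (cycle_graph n) r \<le> 4 * 2 ^ (10 * r\<^sup>2)"
      using size_ramsey_cycle_small[OF r n(2) True] .
    also have "\<dots> \<le> 24 * 2 ^ (16 * r\<^sup>2) * 1" unfolding mult_1_right
      using r by (intro mult_le_mono power_increasing) auto
    also have "\<dots> \<le> 24 * 2 ^ (16 * r\<^sup>2) * n" using n by (intro mult_le_mono) auto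
    finally show ?thesis .
  next
    case False
    \<comment> \<open>This gives \<open>12 * r \<le> 6 * r\<^sup>2\<close>, so the exponent is at
      most \<open>15 * r\<^sup>2\<close>.\<close>
    have "r * 2 \<le> r * r" using r by simp
    then have "9 * r\<^sup>2 + 12 * r \<le> 16 * r\<^sup>2" unfolding power2_eq_square by linarith
    then have "24 * 2 ^ (9 * r\<^sup>2 + 12 * r) * n \<le> 24 * 2 ^ (16 * r\<^sup>2) * n"
      by (intro mult_le_mono power_increasing) auto
    moreover have "size_ramsey (cycle_graph n) r \<le> 24 * 2 ^ (9 * r\<^sup>2 + 12 * r) * n"
      using size_ramsey_cycle_large[OF r n(1)] False by simp
    ultimately show ?thesis by (rule order_trans[rotated])
  qed
  also have "\<dots> \<le> r ^ 2 * (24 * 2 ^ (16 * r\<^sup>2) * n)" using r by simp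
  finally have "real (size_ramsey (cycle_graph n) r) \<le> real (r ^ 2 * (24 * 2 ^ (16 * r\<^sup>2) * n))"
    by (rule of_nat_mono)
  then show "real (size_ramsey (cycle_graph n) r) \<le> 24 * real r ^ 2 * 2 ^ (16 * r ^ 2) * real n"
    by (simp add: mult_ac)
qed simp

end
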